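(* If $G$ is a graph with ${\rm tdom}(G)=1$, then Staller has a winning strategy in the S-game of the Maker-Breaker total domination game on $G$.
   Context: All graphs are finite and simple. The Maker-Breaker total domination game on a graph $G$ is played by Dominator and Staller, who alternately select a vertex of $G$ not selected before. Dominator wins if at some point the set of vertices he has selected is a total dominating set of $G$ (a set $D$ such that every vertex of $G$ has a neighbour in $D$); otherwise Staller wins. The S-game is the game in which Staller moves first. The total domatic number ${\rm tdom}(G)$ is the maximum number of total dominating sets into which $V(G)$ can be partitioned. *)

theory Defs
  imports "Graph_Theory.Digraph" "HOL-Library.Disjoint_Sets"
begin

(* Finite simple graphs are the locale predicate graph of Graph_Theory: finite, loop-free
   symmetric digraphs without parallel arcs. Adjacency of u and v is dominates G u v. *)

definition total_dominating_set :: "('a, 'b) pre_digraph \<Rightarrow> 'a set \<Rightarrow> bool" where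
  "total_dominating_set G D \<longleftrightarrow> D \<subseteq> verts G \<and> (\<forall>v\<in>verts G. \<exists>u\<in>D. v \<rightarrow>\<^bsub>G\<^esub> u)"

(* For finite G this is a set of naturals bounded by card (verts G), so Sup is the maximum;
   it is 0 if there is no such partition, i.e. if G has an isolated vertex. *)
definition tdom :: "('a, 'b) pre_digraph \<Rightarrow> nat" where
  "tdom G = Sup {card P | P. partition_on (verts G) P \<and> (\<forall>D\<in>P. total_dominating_set G D)}"

(* The position reached after the moves p!0, p!1, ...; in the S-game the moves at even
   indices are Staller's and those at odd indices are Dominator's. *)
definition play :: "('a, 'b) pre_digraph \<Rightarrow> 'a list \<Rightarrow> bool" where
  "play G p \<longleftrightarrow> distinct p \<and> set p \<subseteq> verts G"

definition complete_play :: "('a, 'b) pre_digraph \<Rightarrow> 'a list \<Rightarrow> bool" where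
  "complete_play G p \<longleftrightarrow> play G p \<and> set p = verts G"

definition dominator_vertices :: "'a list \<Rightarrow> 'a set" where
  "dominator_vertices p = {p ! i | i. i < length p \<and> odd i}"

definition dominator_wins :: "('a, 'b) pre_digraph \<Rightarrow> 'a list \<Rightarrow> bool" where
  "dominator_wins G p \<longleftrightarrow>
     (\<exists>k\<le>length p. total_dominating_set G (dominator_vertices (take k p)))"

(* A strategy for Staller maps the list of all moves made so far to her next move. *)
definition follows :: "('a list \<Rightarrow> 'a) \<Rightarrow> 'a list \<Rightarrow> bool" where
  "follows \<sigma> p \<longleftrightarrow> (\<forall>i<length p. even i \<longrightarrow> p ! i = \<sigma> (take i p))"

(* The first conjunct makes the strategy legal: without it, the second could hold vacuously
   for a strategy that gets stuck. Play going on after Dominator has won is harmless, as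
   dominator_wins takes every earlier position into account. *)
definition staller_winning_strategy :: "('a, 'b) pre_digraph \<Rightarrow> ('a list \<Rightarrow> 'a) \<Rightarrow> bool" where
  "staller_winning_strategy G \<sigma> \<longleftrightarrow>
     (\<forall>p. play G p \<and> follows \<sigma> p \<and> even (length p) \<and> set p \<noteq> verts G
          \<longrightarrow> \<sigma> p \<in> verts G - set p) \<and>
     (\<forall>p. complete_play G p \<and> follows \<sigma> p \<longrightarrow> \<not> dominator_wins G p)"

end

(* Strategy stealing. Finite play is determined, so if Staller does not win as first player,
   Dominator wins as second player. Staller can then imitate Dominator's winning strategy: she
   makes an arbitrary move and from then on pretends not to have made it, replying to Dominator as
   if he were the first player. If both play this way, both end up with total dominating sets,
   which partition the vertices; so tdom would be at least 2. *)
theory Submission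
  imports Defs
begin

section \<open>The game on positions and strategy stealing\<close>

text \<open>In a position \<open>A, B\<close> Staller holds \<open>A\<close> and Dominator holds \<open>B\<close>; the board is \<open>V\<close>, and
  Dominator wants his final set to satisfy \<open>T\<close>. In \<open>staller_first\<close> it is Staller's turn, in
  \<open>staller_second\<close> Dominator's.\<close>

inductive staller_first :: "'a set \<Rightarrow> ('a set \<Rightarrow> bool) \<Rightarrow> 'a set \<Rightarrow> 'a set \<Rightarrow> bool"
  and staller_second :: "'a set \<Rightarrow> ('a set \<Rightarrow> bool) \<Rightarrow> 'a set \<Rightarrow> 'a set \<Rightarrow> bool"
  for V T where
  "V - (A \<union> B) = {} \<Longrightarrow> \<not> T B \<Longrightarrow> staller_first V T A B"
| "x \<in> V - (A \<union> B) \<Longrightarrow> staller_second V T (insert x A) B \<Longrightarrow> staller_first V T A B"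
| "V - (A \<union> B) = {} \<Longrightarrow> \<not> T B \<Longrightarrow> staller_second V T A B"
| "V - (A \<union> B) \<noteq> {} \<Longrightarrow> \<forall>y\<in>V - (A \<union> B). staller_first V T A (insert y B)
    \<Longrightarrow> staller_second V T A B"

lemma staller_first_full:
  "V - (A \<union> B) = {} \<Longrightarrow> staller_first V T A B \<longleftrightarrow> \<not> T B"
  by (subst staller_first.simps) blast

lemma staller_first_move:
  "V - (A \<union> B) \<noteq> {} \<Longrightarrow>
    staller_first V T A B \<longleftrightarrow> (\<exists>x\<in>V - (A \<union> B). staller_second V T (insert x A) B)"
  by (subst staller_first.simps) blast

text \<open>The guard in the last introduction rule is what makes this true: without it, the
  universal statement would hold vacuously on a full board and Staller would always win
  there.\<close>

lemma staller_second_full: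
  "V - (A \<union> B) = {} \<Longrightarrow> staller_second V T A B \<longleftrightarrow> \<not> T B"
  by (subst staller_second.simps) blast

lemma staller_second_move:
  "V - (A \<union> B) \<noteq> {} \<Longrightarrow>
    staller_second V T A B \<longleftrightarrow> (\<forall>y\<in>V - (A \<union> B). staller_first V T A (insert y B))"
  by (subst staller_second.simps) blast

text \<open>Determinacy is built into the encoding: a position not won by Staller counts as won by
  Dominator. Negating \<exists> over her moves leaves him winning whatever she does, and negating
  \<forall> over his moves, in the next lemma, supplies his winning reply.\<close>

lemma not_staller_first_moveD:
  "\<not> staller_first V T A B \<Longrightarrow> x \<in> V - (A \<union> B) \<Longrightarrow>
    \<not> staller_second V T (insert x A) B"
  by (metis staller_first_staller_second.intros(2))

lemma not_staller_second_moveE: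
  assumes "\<not> staller_second V T A B" "V - (A \<union> B) \<noteq> {}"
  obtains y where "y \<in> V - (A \<union> B)" "\<not> staller_first V T A (insert y B)"
  using assms staller_second_move by metis

text \<open>The vertex \<open>x\<close> is the move that Staller pretends not to have made: in her imagined game
  the roles are swapped, and she holds \<open>A - {x}\<close> as the second player.\<close>

lemma strategy_stealing_step:
  assumes "finite V"
    and mono: "\<And>C D. T C \<Longrightarrow> C \<subseteq> D \<Longrightarrow> D \<subseteq> V \<Longrightarrow> T D"
    and "A \<subseteq> V" "B \<subseteq> V" "A \<inter> B = {}" "x \<in> A"
    and "\<not> staller_second V T A B" "\<not> staller_first V T B (A - {x})"
  shows "\<exists>D\<subseteq>V. T D \<and> T (V - D)"
  using assms(3-)
proof (induction "card (V - (A \<union> B))" arbitrary: A B x rule: less_induct)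
  case less
  show ?case
  proof (cases "V - (A \<union> B) = {}")
    case True
    have "T B"
      using less.prems True by (simp add: staller_second_full)
    \<comment> \<open>The real board is full, but \<open>x\<close> is still free in the imagined
      game. There it is the first player's last move, so the second player wins with
      \<open>A - {x}\<close>; \<open>mono\<close> then puts \<open>x\<close> back.\<close>
    have "x \<in> V - (B \<union> (A - {x}))"
      using less.prems(1,3,4) by blast
    then have "\<not> staller_second V T (insert x B) (A - {x})"
      by (rule not_staller_first_moveD[OF less.prems(6)])
    moreover have "V - (insert x B \<union> (A - {x})) = {}"
      using True by blast
    ultimately have "T (A - {x})"
      by (simp add: staller_second_full)
    then have "T A"
      using mono less.prems by blast
    moreover have "V - A = B"
      using less.prems True by blast
    ultimately show ?thesis
      using \<open>T B\<close> less.prems by blast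
  next
    case False
    then obtain y where y: "y \<in> V - (A \<union> B)" and real: "\<not> staller_first V T A (insert y B)"
      by (rule not_staller_second_moveE[OF less.prems(5)])
    \<comment> \<open>Dominator's winning move \<open>y\<close> is copied into the imagined game as
      a move of the first player. A reply \<open>z\<close> exists there because \<open>x\<close> at
      least is free.\<close>
    have "y \<in> V - (B \<union> (A - {x}))"
      using y by blast
    then have "\<not> staller_second V T (insert y B) (A - {x})"
      by (rule not_staller_first_moveD[OF less.prems(6)])
    moreover have "x \<in> V - (insert y B \<union> (A - {x}))"
      using less.prems y by blast
    ultimately obtain z where z: "z \<in> V - (insert y B \<union> (A - {x}))"
      and imagined: "\<not> staller_first V T (insert y B) (insert z (A - {x}))"
      by (blast elim: not_staller_second_moveE)
    \<comment> \<open>A round ends with Staller's real move \<open>x'\<close>; \<open>w\<close> is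
      the vertex that she ignores from then on. The round uses up the free vertices \<open>y\<close>
      and \<open>x'\<close>, so the induction hypothesis applies.\<close>
    have continue: ?thesis
      if "x' \<in> V - (A \<union> insert y B)" "w \<in> insert x' A"
        "\<not> staller_first V T (insert y B) (insert x' A - {w})" for x' w
    proof (rule less.hyps[of "insert x' A" "insert y B" w])
      show "card (V - (insert x' A \<union> insert y B)) < card (V - (A \<union> B))"
        using y \<open>finite V\<close> by (intro psubset_card_mono) auto
      show "\<not> staller_second V T (insert x' A) (insert y B)"
        by (rule not_staller_first_moveD[OF real that(1)])
    qed (use that less.prems y in auto)
    show ?thesis
    proof (cases "z = x")
      case False
      then have "insert z A - {x} = insert z (A - {x})"
        by blast
      then show ?thesis
        using continue[of z x] z less.prems imagined by auto
    next
      \<comment> \<open>The imagined reply is the vertex that Staller already holds, so the two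
        positions now agree up to swapping the roles. If a vertex is left, she takes any
        \<open>x'\<close> and ignores that one instead; otherwise both games are over and both sides
        have won.\<close>
      case z_eq: True
      then have imagined: "\<not> staller_first V T (insert y B) A"
        using imagined less.prems by (simp add: insert_absorb)
      show ?thesis
      proof (cases "V - (A \<union> insert y B) = {}")
        case True
        moreover have "V - (insert y B \<union> A) = {}"
          using True by blast
        ultimately have "T (insert y B)" "T A"
          using real imagined by (simp_all add: staller_first_full)
        moreover have "V - A = insert y B"
          using less.prems True y by blast
        ultimately show ?thesis
          using less.prems by auto
      next
        case False
        then obtain x' where x': "x' \<in> V - (A \<union> insert y B)"
          by blast
        then have "insert x' A - {x'} = A"
          by blast
        then show ?thesis
          using continue[of x' x'] x' imagined by auto
      qed
    qed
  qed
qed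

lemma strategy_stealing:
  assumes "finite V"
    and mono: "\<And>C D. T C \<Longrightarrow> C \<subseteq> D \<Longrightarrow> D \<subseteq> V \<Longrightarrow> T D"
    and "\<not> staller_first V T {} {}"
  shows "\<exists>D\<subseteq>V. T D \<and> T (V - D)"
proof (cases "V = {}")
  \<comment> \<open>There is no vertex for the arbitrary first move, but the game is already over
    and the empty set satisfies \<open>T\<close>.\<close>
  case True
  then show ?thesis
    using assms(3) by (auto simp: staller_first_full)
next
  case False
  then obtain x where "x \<in> V"
    by blast
  then have "\<not> staller_second V T {x} {}"
    using not_staller_first_moveD[OF assms(3)] by simp
  with \<open>x \<in> V\<close> show ?thesis
    using strategy_stealing_step[of V T "{x}" "{}" x] assms by auto
qed

section \<open>From won positions to strategies on move sequences\<close>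

lemma dominator_vertices_subset: "dominator_vertices p \<subseteq> set p"
  by (auto simp: dominator_vertices_def)

lemma dominator_vertices_snoc:
  fixes p :: "'a list"
  shows "dominator_vertices (p @ [x]) =
    (if odd (length p) then insert x (dominator_vertices p) else dominator_vertices p)"
proof -
  have image: "dominator_vertices q = (!) q ` {i. i < length q \<and> odd i}" for q :: "'a list"
    by (auto simp: dominator_vertices_def)
  have "{i. i < length (p @ [x]) \<and> odd i} =
      (if odd (length p) then insert (length p) {i. i < length p \<and> odd i}
       else {i. i < length p \<and> odd i})"
    by (auto simp: less_Suc_eq)
  moreover have "(!) (p @ [x]) ` {i. i < length p \<and> odd i} = (!) p ` {i. i < length p \<and> odd i}"
    by (intro image_cong) (auto simp: nth_append)
  ultimately show ?thesis
    by (simp add: image)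
qed

lemma dominator_vertices_take: "dominator_vertices (take k p) \<subseteq> dominator_vertices p"
  by (auto simp: dominator_vertices_def)

lemma follows_snoc:
  "follows \<sigma> (p @ [x]) \<longleftrightarrow> follows \<sigma> p \<and> (even (length p) \<longrightarrow> x = \<sigma> p)"
  by (auto simp: follows_def nth_append less_Suc_eq)

lemma total_dominating_set_mono:
  "total_dominating_set G C \<Longrightarrow> C \<subseteq> D \<Longrightarrow> D \<subseteq> verts G \<Longrightarrow> total_dominating_set G D"
  unfolding total_dominating_set_def by blast

text \<open>A strategy sees the whole list of moves, whereas \<open>staller_first\<close> sees only
  the position. So \<open>\<sigma>\<close> reads the position off the list and picks any move that
  keeps it won for Staller.\<close>

lemma staller_first_imp_winning_strategy:
  fixes G :: "('a, 'b) pre_digraph"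
  assumes win: "staller_first (verts G) (total_dominating_set G) {} {}"
  shows "\<exists>\<sigma>. staller_winning_strategy G \<sigma>"
proof -
  let ?V = "verts G" and ?T = "total_dominating_set G"
  define S :: "'a list \<Rightarrow> 'a set" where "S p = set p - dominator_vertices p" for p
  define good where
    "good p x \<longleftrightarrow> x \<in> ?V - set p \<and> staller_second ?V ?T (insert x (S p)) (dominator_vertices p)"
    for p x
  \<comment> \<open>Where no good move exists the choice is arbitrary. This does no harm: by
    \<open>inv\<close>, plays that follow \<open>\<sigma>\<close> never leave the won
    positions.\<close>
  define \<sigma> where "\<sigma> p = (SOME x. good p x)" for p
  have held: "S p \<union> dominator_vertices p = set p" for p
    using dominator_vertices_subset[of p] by (auto simp: S_def)
  have good: "good p (\<sigma> p)"
    if "staller_first ?V ?T (S p) (dominator_vertices p)" "?V - set p \<noteq> {}" for p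
    unfolding \<sigma>_def
    by (rule someI_ex)
      (use that staller_first_move[of ?V "S p" "dominator_vertices p"] in
        \<open>auto simp: good_def held\<close>)
  have inv: "if even (length p) then staller_first ?V ?T (S p) (dominator_vertices p)
      else staller_second ?V ?T (S p) (dominator_vertices p)"
    if "play G p" "follows \<sigma> p" for p
    using that
  proof (induction p rule: rev_induct)
    case Nil
    then show ?case
      using win by (simp add: S_def dominator_vertices_def)
  next
    case (snoc x p)
    then have x: "x \<in> ?V - set p" and IH: "if even (length p)
      then staller_first ?V ?T (S p) (dominator_vertices p)
      else staller_second ?V ?T (S p) (dominator_vertices p)"
      by (auto simp: play_def follows_snoc)
    have S_snoc: "S (p @ [x]) = (if even (length p) then insert x (S p) else S p)"
      using x dominator_vertices_subset[of p] by (auto simp: S_def dominator_vertices_snoc)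
    show ?case
    proof (cases "even (length p)")
      case True
      then have "good p x"
        using good[of p] IH x snoc.prems by (auto simp: follows_snoc)
      then show ?thesis
        using True by (simp add: S_snoc dominator_vertices_snoc good_def)
    next
      case False
      then show ?thesis
        using IH x staller_second_move[of ?V "S p" "dominator_vertices p"]
        by (auto simp: S_snoc dominator_vertices_snoc held)
    qed
  qed
  have "\<sigma> p \<in> ?V - set p"
    if "play G p" "follows \<sigma> p" "even (length p)" "set p \<noteq> ?V" for p
  proof -
    have "staller_first ?V ?T (S p) (dominator_vertices p)"
      using inv[OF that(1,2)] that(3) by simp
    moreover have "?V - set p \<noteq> {}"
      using that(1,4) by (auto simp: play_def)
    ultimately show ?thesis
      using good good_def by blast
  qed
  moreover have "\<not> dominator_wins G p" if "complete_play G p" "follows \<sigma> p" for p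
  proof -
    have p: "play G p" "set p = ?V"
      using that by (auto simp: complete_play_def)
    then have "?V - (S p \<union> dominator_vertices p) = {}"
      using p(2) held by simp
    then have "\<not> ?T (dominator_vertices p)"
      using inv[OF p(1) that(2)] by (cases "even (length p)")
        (simp_all add: staller_first_full staller_second_full)
    \<comment> \<open>Supersets within the board stay total dominating, so a win of Dominator at an
      earlier position would persist to the end; only his final set matters.\<close>
    moreover have "dominator_vertices p \<subseteq> ?V"
      using dominator_vertices_subset[of p] p(2) by simp
    ultimately show ?thesis
      unfolding dominator_wins_def
      using total_dominating_set_mono[OF _ dominator_vertices_take] by metis
  qed
  ultimately show ?thesis
    unfolding staller_winning_strategy_def by blast
qed

section \<open>Bounds on the total domatic number\<close>

lemma card_le_tdom:
  assumes "finite (verts G)" "partition_on (verts G) P" "\<forall>D\<in>P. total_dominating_set G D"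
  shows "card P \<le> tdom G"
  unfolding tdom_def
proof (rule cSup_upper)
  \<comment> \<open>\<open>Sup\<close> on the naturals bounds the members only of a bounded set;
    here there are finitely many partitions.\<close>
  have "finite {P. partition_on (verts G) P}"
    using assms(1) by (rule finitely_many_partition_on)
  then have "finite (card ` {P. partition_on (verts G) P})"
    by blast
  then have "finite {card P |P. partition_on (verts G) P \<and> (\<forall>D\<in>P. total_dominating_set G D)}"
    by (rule rev_finite_subset) blast
  then show "bdd_above {card P |P. partition_on (verts G) P \<and> (\<forall>D\<in>P. total_dominating_set G D)}"
    by (rule bdd_above_finite)
  show "card P \<in> {card P |P. partition_on (verts G) P \<and> (\<forall>D\<in>P. total_dominating_set G D)}"
    by (intro CollectI exI[of _ P] conjI refl assms(2,3))
qed

text \<open>The empty set has only the empty partition. The main proof uses this to exclude the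
  graph without vertices, where Dominator wins at once and the two total dominating sets would both
  be empty.\<close>

lemma tdom_no_vertices: "verts G = {} \<Longrightarrow> tdom G = 0"
proof -
  assume "verts G = {}"
  then have "{card P |P. partition_on (verts G) P \<and> (\<forall>D\<in>P. total_dominating_set G D)} = {0}"
    by (auto simp: partition_on_empty)
  then show ?thesis
    by (simp add: tdom_def)
qed

lemma two_le_tdom:
  assumes "finite (verts G)" "verts G \<noteq> {}" "D \<subseteq> verts G"
    and "total_dominating_set G D" "total_dominating_set G (verts G - D)"
  shows "2 \<le> tdom G"
proof -
  \<comment> \<open>Any vertex has a neighbour in each of the two sets, so neither is empty and they
    are distinct blocks.\<close>
  have "D \<noteq> {}" "verts G - D \<noteq> {}"
    using assms unfolding total_dominating_set_def by blast+
  then have "D \<noteq> verts G - D" "partition_on (verts G) {D, verts G - D}"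
    using assms(3) by (auto simp: partition_on_def disjoint_def)
  then show ?thesis
    using card_le_tdom[of G "{D, verts G - D}"] assms by simp
qed

theorem theorem3p1:
  fixes G :: "('a, 'b) pre_digraph"
  assumes "graph G"
    and "tdom G = 1"
  shows "\<exists>\<sigma>. staller_winning_strategy G \<sigma>"
proof (rule staller_first_imp_winning_strategy, rule ccontr)
  interpret graph G
    by fact
  assume "\<not> staller_first (verts G) (total_dominating_set G) {} {}"
  then have "\<exists>D\<subseteq>verts G. total_dominating_set G D \<and> total_dominating_set G (verts G - D)"
    using strategy_stealing[where T = "total_dominating_set G", OF finite_verts]
      total_dominating_set_mono by metis
  then obtain D where
    "D \<subseteq> verts G" "total_dominating_set G D" "total_dominating_set G (verts G - D)"
    by blast
  moreover have "verts G \<noteq> {}"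
    using tdom_no_vertices[of G] assms(2) by auto
  ultimately have "2 \<le> tdom G"
    by (intro two_le_tdom finite_verts)
  then show False
    using assms(2) by simp
qed

end
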